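(* For the two-user discrete memoryless multiple access channel with state $(\mathcal{X}_1,\mathcal{X}_2,\mathcal{S},\mathcal{Y},P(y|x_1,x_2,s))$, with the state sequence known non-causally at both encoders and perfect causal output feedback to both encoders, every achievable rate pair $(R_1,R_2)$ lies in $\mathcal{R}_o^{MAC}$, the set of all rate pairs for which there exist random variables $(S,V_1,V_2,X_1,X_2,Y)$ with joint distribution $P(s)P(v_1,v_2,x_1,x_2|s)P(y|x_1,x_2,s)$ (for some conditional distribution $P(v_1,v_2,x_1,x_2|s)$) such that $$R_1\le I(V_1;Y|V_2)-I(V_1;S|V_2),\qquad R_2\le I(V_2;Y|V_1)-I(V_2;S|V_1),$$ $$R_1+R_2\le I(V_1,V_2;Y)-I(V_1,V_2;S).$$ That is, $\mathcal{C}_{fb,nc}^{MAC}\subseteq\mathcal{R}_o^{MAC}$.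
   Context: The channel is memoryless: $P(y^n|x_1^n,x_2^n,s^n)=\prod_{k=1}^n P(y_k|x_{1,k},x_{2,k},s_k)$ and $P(s^n)=\prod_{k=1}^n P(s_k)$. An $(R_1,R_2,n)$ code with feedback and non-causal state information consists of encoding functions $f_{i,k}:\{1,\dots,2^{nR_i}\}\times\mathcal{S}^n\times\mathcal{Y}^{k-1}\to\mathcal{X}_i$, $i=1,2$, $k=1,\dots,n$, with channel input $x_{i,k}=f_{i,k}(w_i,s^n,y^{k-1})$, and a decoding function $g:\mathcal{Y}^n\to\{1,\dots,2^{nR_1}\}\times\{1,\dots,2^{nR_2}\}$. Messages $(w_1,w_2)$ are independent, uniform, and independent of $S^n$; $P_e$ is the average error probability. A rate pair is achievable if there is a sequence of such codes with $P_e\to0$. $\mathcal{C}_{fb,nc}^{MAC}$ is the closure of the set of achievable rate pairs. $V_1,V_2$ are auxiliary random variables (alphabets not restricted). *)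

theory Defs
  imports "HOL-Probability.Probability"
begin

definition ent :: "'a pmf \<Rightarrow> real" where
  "ent p = - (\<Sum>a\<in>set_pmf p. pmf p a * log 2 (pmf p a))"

definition mi :: "('a \<times> 'b) pmf \<Rightarrow> real" where
  "mi p = ent (map_pmf fst p) + ent (map_pmf snd p) - ent p"

definition cmi :: "('a \<times> 'b \<times> 'c) pmf \<Rightarrow> real" where
  "cmi p = ent (map_pmf (\<lambda>(a,b,c). (a,c)) p) + ent (map_pmf (\<lambda>(a,b,c). (b,c)) p)
           - ent p - ent (map_pmf (\<lambda>(a,b,c). c) p)"

text \<open>Number of messages of a code of rate R and block length n: the message set
  {1..2^(nR)} is taken as {0..<ceil(2^(nR))}.\<close>
definition msize :: "nat \<Rightarrow> real \<Rightarrow> nat" where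
  "msize n R = nat \<lceil>2 powr (real n * R)\<rceil>"

text \<open>Average error probability of a code of block length n with M1, M2 messages.
  Encoder i at time k (0-based) sees the message, the whole state sequence and
  the past outputs (take k y); the decoder sees the output sequence.\<close>
definition pe ::
  "'s pmf \<Rightarrow> ('x1 \<Rightarrow> 'x2 \<Rightarrow> 's \<Rightarrow> 'y pmf) \<Rightarrow> nat \<Rightarrow> nat \<Rightarrow> nat \<Rightarrow>
   (nat \<Rightarrow> nat \<Rightarrow> 's list \<Rightarrow> 'y list \<Rightarrow> 'x1) \<Rightarrow>
   (nat \<Rightarrow> nat \<Rightarrow> 's list \<Rightarrow> 'y list \<Rightarrow> 'x2) \<Rightarrow>
   ('y list \<Rightarrow> nat \<times> nat) \<Rightarrow> real" where
  "pe PS W n M1 M2 f1 f2 g =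
     (1 / (real M1 * real M2)) *
     (\<Sum>w1<M1. \<Sum>w2<M2. \<Sum>s\<in>{s. length s = n}. \<Sum>y\<in>{y. length y = n}.
        (\<Prod>k<n. pmf PS (s ! k)) *
        (\<Prod>k<n. pmf (W (f1 k w1 s (take k y)) (f2 k w2 s (take k y)) (s ! k)) (y ! k)) *
        (if g y \<noteq> (w1, w2) then 1 else 0))"

definition achievable ::
  "'s pmf \<Rightarrow> ('x1 \<Rightarrow> 'x2 \<Rightarrow> 's \<Rightarrow> 'y pmf) \<Rightarrow> real \<Rightarrow> real \<Rightarrow> bool" where
  "achievable PS W R1 R2 \<longleftrightarrow> 0 \<le> R1 \<and> 0 \<le> R2 \<and>
     (\<exists>(f1 :: nat \<Rightarrow> nat \<Rightarrow> nat \<Rightarrow> 's list \<Rightarrow> 'y list \<Rightarrow> 'x1)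
       (f2 :: nat \<Rightarrow> nat \<Rightarrow> nat \<Rightarrow> 's list \<Rightarrow> 'y list \<Rightarrow> 'x2)
       (g :: nat \<Rightarrow> 'y list \<Rightarrow> nat \<times> nat).
        (\<lambda>n. pe PS W n (msize n R1) (msize n R2) (f1 n) (f2 n) (g n)) \<longlonglongrightarrow> 0)"

definition cap_region_fb_nc ::
  "'s pmf \<Rightarrow> ('x1 \<Rightarrow> 'x2 \<Rightarrow> 's \<Rightarrow> 'y pmf) \<Rightarrow> (real \<times> real) set" where
  "cap_region_fb_nc PS W = closure {(R1, R2). achievable PS W R1 R2}"

definition joint ::
  "'s pmf \<Rightarrow> ('x1 \<Rightarrow> 'x2 \<Rightarrow> 's \<Rightarrow> 'y pmf) \<Rightarrow> ('s \<Rightarrow> ('v \<times> 'v \<times> 'x1 \<times> 'x2) pmf)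
   \<Rightarrow> ('s \<times> 'v \<times> 'v \<times> 'x1 \<times> 'x2 \<times> 'y) pmf" where
  "joint PS W Q =
     bind_pmf PS (\<lambda>s. bind_pmf (Q s) (\<lambda>(v1, v2, x1, x2).
        map_pmf (\<lambda>y. (s, v1, v2, x1, x2, y)) (W x1 x2 s)))"

definition outer_region ::
  "'s pmf \<Rightarrow> ('x1 \<Rightarrow> 'x2 \<Rightarrow> 's \<Rightarrow> 'y pmf) \<Rightarrow> (real \<times> real) set" where
  "outer_region PS W = {(R1, R2). \<exists>Q :: 's \<Rightarrow> (nat \<times> nat \<times> 'x1 \<times> 'x2) pmf.
     (\<forall>s. finite (set_pmf (Q s))) \<and>
     (let J = joint PS W Q in
       R1 \<le> cmi (map_pmf (\<lambda>(s,v1,v2,x1,x2,y). (v1, y, v2)) J)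
             - cmi (map_pmf (\<lambda>(s,v1,v2,x1,x2,y). (v1, s, v2)) J) \<and>
       R2 \<le> cmi (map_pmf (\<lambda>(s,v1,v2,x1,x2,y). (v2, y, v1)) J)
             - cmi (map_pmf (\<lambda>(s,v1,v2,x1,x2,y). (v2, s, v1)) J) \<and>
       R1 + R2 \<le> mi (map_pmf (\<lambda>(s,v1,v2,x1,x2,y). ((v1, v2), y)) J)
             - mi (map_pmf (\<lambda>(s,v1,v2,x1,x2,y). ((v1, v2), s)) J))}"

end

theory Submission
  imports Defs "HOL-Real_Asymp.Real_Asymp"
begin

text \<open>Let \<open>C\<close> be the maximum of \<open>I(V;Y) - I(V;S)\<close> over all laws \<open>P(s) P(v,x\<^sub>1,x\<^sub>2|s) P(y|x\<^sub>1,x\<^sub>2,s)\<close>.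
  Since \<open>P(v\<^sub>1,v\<^sub>2,x\<^sub>1,x\<^sub>2|s)\<close> is unrestricted, giving an optimal \<open>V\<close> entirely to user 1 or entirely
  to user 2 and time sharing between the two choices shows that the outer region contains the closed
  triangle \<open>R\<^sub>1, R\<^sub>2 \<ge> 0\<close>, \<open>R\<^sub>1 + R\<^sub>2 \<le> C\<close>. Conversely, treating \<open>(W\<^sub>1, W\<^sub>2)\<close> as one message, the
  Gelfand-Pinsker converse with feedback bounds the sum rate of every achievable pair by \<open>C\<close>. The
  maximum is attained by compactness, so taking the closure does no harm.\<close>

section \<open>Entropy\<close>

lemma sum_map_pmf:
  fixes h :: "'b \<Rightarrow> real"
  assumes "finite (set_pmf p)"
  shows "(\<Sum>x\<in>set_pmf p. pmf p x * h (f x)) =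
    (\<Sum>b\<in>set_pmf (map_pmf f p). pmf (map_pmf f p) b * h b)"
proof -
  have "(\<Sum>x\<in>set_pmf p. pmf p x * h (f x)) = measure_pmf.expectation p (\<lambda>x. h (f x))"
    using assms by (subst integral_measure_pmf[of "set_pmf p"]) auto
  also have "\<dots> = measure_pmf.expectation (map_pmf f p) h"
    by simp
  also have "\<dots> = (\<Sum>b\<in>set_pmf (map_pmf f p). pmf (map_pmf f p) b * h b)"
    using assms by (subst integral_measure_pmf[of "set_pmf (map_pmf f p)"]) auto
  finally show ?thesis .
qed

lemma pmf_map_sum:
  assumes "finite A" "set_pmf p \<subseteq> A"
  shows "pmf (map_pmf f p) b = (\<Sum>a\<in>A. if f a = b then pmf p a else 0)"
proof -
  have "pmf (map_pmf f p) b = measure_pmf.expectation p (\<lambda>a. pmf (return_pmf (f a)) b)"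
    by (simp add: map_pmf_def pmf_bind)
  also have "\<dots> = (\<Sum>a\<in>A. pmf p a * pmf (return_pmf (f a)) b)"
    using assms by (subst integral_measure_pmf[of A]) auto
  also have "\<dots> = (\<Sum>a\<in>A. if f a = b then pmf p a else 0)"
    by (intro sum.cong) auto
  finally show ?thesis .
qed

lemma pmf_bind_sum:
  assumes "finite A" "set_pmf p \<subseteq> A"
  shows "pmf (bind_pmf p N) b = (\<Sum>a\<in>A. pmf p a * pmf (N a) b)"
  unfolding pmf_bind using assms by (subst integral_measure_pmf[of A]) auto

section \<open>The entropy summand and the chain rule\<close>

text \<open>Since it vanishes at 0, an entropy may be summed over any finite superset of the
  support, and it becomes a continuous function of the point masses.\<close>

definition eta :: "real \<Rightarrow> real" where
  "eta t = - (t * log 2 t)"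

lemma eta_0 [simp]: "eta 0 = 0"
  by (simp add: eta_def)

text \<open>This product rule is the source of both the chain rule for entropy and the scaling law
  of \<open>out_ent\<close>.\<close>

lemma eta_mult: "0 \<le> a \<Longrightarrow> 0 \<le> b \<Longrightarrow> eta (a * b) = a * eta b + b * eta a"
  by (cases "a = 0 \<or> b = 0") (auto simp: eta_def log_mult algebra_simps)

text \<open>Only the boundary point 0 needs care; there t ln t tends to 0.\<close>

lemma continuous_on_eta: "continuous_on {0..} eta"
proof -
  have "((\<lambda>t. t * ln t) \<longlongrightarrow> 0) (at_right (0::real))"
    by real_asymp
  then have "((\<lambda>t. - (t * ln t) / ln 2) \<longlongrightarrow> - 0 / ln 2) (at_right (0::real))"
    by (intro tendsto_intros) auto
  moreover have "eta = (\<lambda>t. - (t * ln t) / ln 2)"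
    by (simp add: fun_eq_iff eta_def log_def)
  ultimately have "(eta \<longlongrightarrow> eta 0) (at_right 0)"
    by simp
  then have "(eta \<longlongrightarrow> eta 0) (at 0 within {0..})"
    by (simp add: at_within_Ici_at_right)
  moreover have "isCont eta x" if "x > 0" for x
    unfolding eta_def using that by (auto intro!: continuous_intros)
  ultimately show ?thesis
    unfolding continuous_on_def
    by (metis atLeast_iff continuous_at_imp_continuous_at_within continuous_within
        order_le_less)
qed

lemma ent_eq_sum:
  assumes "finite A" "set_pmf p \<subseteq> A"
  shows "ent p = (\<Sum>a\<in>A. eta (pmf p a))"
proof -
  have "(\<Sum>a\<in>A. eta (pmf p a)) = (\<Sum>a\<in>set_pmf p. eta (pmf p a))"
    using assms by (intro sum.mono_neutral_right) (auto simp: set_pmf_iff)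
  then show ?thesis
    by (simp add: ent_def eta_def sum_negf)
qed

lemma ent_map_inj:
  assumes "inj_on f (set_pmf p)"
  shows "ent (map_pmf f p) = ent p"
  using assms by (simp add: ent_def sum.reindex pmf_map_inj)

lemma ent_return [simp]: "ent (return_pmf x) = 0"
  by (simp add: ent_def)

lemma pmf_bind_Pair:
  assumes "finite (set_pmf p)"
  shows "pmf (bind_pmf p (\<lambda>a. map_pmf (Pair a) (N a))) (a, b) = pmf p a * pmf (N a) b"
proof -
  have "pmf (map_pmf (Pair a') (N a')) (a, b) = (if a' = a then pmf (N a) b else 0)" for a'
    by (cases "a' = a") (auto simp: pmf_map_inj' inj_on_def intro!: pmf_map_outside)
  then have "pmf (bind_pmf p (\<lambda>a. map_pmf (Pair a) (N a))) (a, b) =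
      (\<Sum>a'\<in>insert a (set_pmf p). pmf p a' * (if a' = a then pmf (N a) b else 0))"
    using assms by (subst pmf_bind_sum[of "insert a (set_pmf p)"]) auto
  also have "\<dots> = (\<Sum>a'\<in>insert a (set_pmf p). if a' = a then pmf p a * pmf (N a) b else 0)"
    by (intro sum.cong) auto
  finally show ?thesis
    using assms by simp
qed

text \<open>The chain rule H(A,B) = H(A) + H(B|A): \<open>eta_mult\<close> splits each summand, and
  the kernel masses sum to 1.\<close>

lemma ent_bind_Pair:
  assumes p: "finite (set_pmf p)" and N: "\<And>a. a \<in> set_pmf p \<Longrightarrow> finite (set_pmf (N a))"
  shows "ent (bind_pmf p (\<lambda>a. map_pmf (Pair a) (N a))) =
    ent p + (\<Sum>a\<in>set_pmf p. pmf p a * ent (N a))"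
proof -
  let ?J = "bind_pmf p (\<lambda>a. map_pmf (Pair a) (N a))"
  note pmfJ = pmf_bind_Pair[OF p]
  have "ent ?J = (\<Sum>(a, b)\<in>Sigma (set_pmf p) (\<lambda>a. set_pmf (N a)). eta (pmf ?J (a, b)))"
    using p N by (subst ent_eq_sum[of "Sigma (set_pmf p) (\<lambda>a. set_pmf (N a))"]) (auto intro!: sum.cong)
  also have "\<dots> = (\<Sum>a\<in>set_pmf p. \<Sum>b\<in>set_pmf (N a). eta (pmf ?J (a, b)))"
    using p N by (subst sum.Sigma) auto
  also have "\<dots> = (\<Sum>a\<in>set_pmf p. eta (pmf p a) + pmf p a * ent (N a))"
  proof (intro sum.cong refl)
    fix a assume a: "a \<in> set_pmf p"
    have "(\<Sum>b\<in>set_pmf (N a). eta (pmf ?J (a, b))) =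
      (\<Sum>b\<in>set_pmf (N a). pmf (N a) b * eta (pmf p a) + pmf p a * eta (pmf (N a) b))"
      by (intro sum.cong) (simp_all add: a pmfJ eta_mult)
    also have "\<dots> = eta (pmf p a) + pmf p a * ent (N a)"
      using N[OF a] by (simp add: sum.distrib sum_distrib_left[symmetric]
          sum_distrib_right[symmetric] sum_pmf_eq_1 ent_eq_sum[of "set_pmf (N a)"])
    finally show "(\<Sum>b\<in>set_pmf (N a). eta (pmf ?J (a, b))) = eta (pmf p a) + pmf p a * ent (N a)" .
  qed
  also have "\<dots> = ent p + (\<Sum>a\<in>set_pmf p. pmf p a * ent (N a))"
    using p by (simp add: sum.distrib ent_eq_sum[of "set_pmf p"])
  finally show ?thesis .
qed

lemma pair_pmf_eq_bind: "pair_pmf A B = bind_pmf A (\<lambda>a. map_pmf (Pair a) B)"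
  by (simp add: pair_pmf_def map_pmf_def)

lemma ent_pair_pmf:
  assumes "finite (set_pmf A)" "finite (set_pmf B)"
  shows "ent (pair_pmf A B) = ent A + ent B"
  using assms by (simp add: pair_pmf_eq_bind ent_bind_Pair sum_distrib_right[symmetric] sum_pmf_eq_1)

section \<open>Gibbs' inequality, subadditivity and Fano's inequality\<close>

text \<open>Follows from ln t \<le> t - 1 with t = q/p. Since \<open>q\<close> may have total mass
  below 1, test laws can be cut down to the support of \<open>p\<close>.\<close>

lemma gibbs:
  assumes p: "finite (set_pmf p)" and q: "\<And>a. a \<in> set_pmf p \<Longrightarrow> 0 < q a"
    and q1: "(\<Sum>a\<in>set_pmf p. q a) \<le> 1"
  shows "ent p \<le> - (\<Sum>a\<in>set_pmf p. pmf p a * log 2 (q a))"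
proof -
  have "(\<Sum>a\<in>set_pmf p. pmf p a * (ln (q a) - ln (pmf p a))) \<le> (\<Sum>a\<in>set_pmf p. q a - pmf p a)"
  proof (intro sum_mono)
    fix a assume a: "a \<in> set_pmf p"
    then have pos: "0 < pmf p a" by (simp add: pmf_positive)
    have "ln (q a / pmf p a) \<le> q a / pmf p a - 1"
      using pos q[OF a] by (intro ln_le_minus_one) simp
    then have "pmf p a * ln (q a / pmf p a) \<le> pmf p a * (q a / pmf p a - 1)"
      using pos by (intro mult_left_mono) auto
    then show "pmf p a * (ln (q a) - ln (pmf p a)) \<le> q a - pmf p a"
      using pos q[OF a] by (simp add: ln_div right_diff_distrib)
  qed
  also have "\<dots> \<le> 0"
    using p q1 by (simp add: sum_subtractf sum_pmf_eq_1)
  finally have "(\<Sum>a\<in>set_pmf p. pmf p a * (ln (q a) - ln (pmf p a))) / ln 2 \<le> 0"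
    by (simp add: divide_nonpos_pos)
  then have "(\<Sum>a\<in>set_pmf p. pmf p a * log 2 (q a) - pmf p a * log 2 (pmf p a)) \<le> 0"
    by (simp add: log_def sum_divide_distrib right_diff_distrib diff_divide_distrib)
  then show ?thesis
    by (simp add: ent_def sum_subtractf)
qed

lemma ent_subadditive:
  fixes p :: "('a \<times> 'b) pmf"
  assumes p: "finite (set_pmf p)"
  shows "ent p \<le> ent (map_pmf fst p) + ent (map_pmf snd p)"
proof -
  let ?f = "\<lambda>x. pmf (map_pmf fst p) (fst x)" and ?g = "\<lambda>x. pmf (map_pmf snd p) (snd x)"
  have pos: "0 < ?f x" "0 < ?g x" if "x \<in> set_pmf p" for x
    using that by (auto intro!: pmf_positive)
  \<comment> \<open>The test law is the product of the marginals; on the support of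
    \<open>p\<close>, a part of the product of the marginal supports, it has mass at most 1.\<close>
  have "(\<Sum>x\<in>set_pmf p. ?f x * ?g x) \<le>
      (\<Sum>x\<in>fst ` set_pmf p \<times> snd ` set_pmf p. ?f x * ?g x)"
    using p by (intro sum_mono2) (auto simp: rev_image_eqI)
  also have "\<dots> = 1"
    using p by (simp add: sum.cartesian_product' sum_distrib_left[symmetric] sum_distrib_right[symmetric]
        sum_pmf_eq_1)
  finally have "ent p \<le> - (\<Sum>x\<in>set_pmf p. pmf p x * log 2 (?f x * ?g x))"
    using pos by (intro gibbs p) auto
  also have "(\<Sum>x\<in>set_pmf p. pmf p x * log 2 (?f x * ?g x)) =
      (\<Sum>x\<in>set_pmf p. pmf p x * log 2 (?f x)) + (\<Sum>x\<in>set_pmf p. pmf p x * log 2 (?g x))"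
    unfolding sum.distrib[symmetric]
  proof (intro sum.cong refl)
    fix x assume "x \<in> set_pmf p"
    with pos[of x] show "pmf p x * log 2 (?f x * ?g x) =
        pmf p x * log 2 (?f x) + pmf p x * log 2 (?g x)"
      by (subst log_mult) (auto simp: distrib_left)
  qed
  also have "- \<dots> = ent (map_pmf fst p) + ent (map_pmf snd p)"
    unfolding ent_def
    using sum_map_pmf[OF p, of "\<lambda>a. log 2 (pmf (map_pmf fst p) a)" fst]
      sum_map_pmf[OF p, of "\<lambda>a. log 2 (pmf (map_pmf snd p) a)" snd] by simp
  finally show ?thesis .
qed

text \<open>Gibbs' inequality against the output law times a test law of the message. The test law
  costs one bit when decoding is right and log |M| more when it is wrong, so the constant 1 stands
  in for the usual binary entropy term.\<close>

lemma fano: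
  fixes p :: "('w \<times> 'y) pmf"
  assumes p: "finite (set_pmf p)" and M: "finite M" "fst ` set_pmf p \<subseteq> M"
  shows "ent p \<le> ent (map_pmf snd p) + 1 +
    measure_pmf.prob p {(w, y). g y \<noteq> w} * log 2 (real (card M))"
proof -
  let ?m = "real (card M)"
  let ?P = "\<lambda>x. pmf (map_pmf snd p) (snd x)"
  \<comment> \<open>A test conditional law of the message given the output:
    half of the mass on the decoded message, half spread uniformly.\<close>
  let ?r = "\<lambda>x. if g (snd x) = fst x then 1 / 2 else 1 / (2 * ?m)"
  let ?err = "{(w, y). g y \<noteq> w}"
  have "M \<noteq> {}" using M set_pmf_not_empty[of p] by auto
  with M have m: "?m > 0" by (simp add: card_gt_0_iff)
  have P: "0 < ?P x" if "x \<in> set_pmf p" for x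
    using that by (auto intro!: pmf_positive)
  have r: "0 < ?r x" for x using m by simp
  have r1: "(\<Sum>w\<in>M. ?r (w, y)) \<le> 1" for y
  proof -
    have "(\<Sum>w\<in>M. ?r (w, y)) \<le> (\<Sum>w\<in>M. (if g y = w then 1 / 2 else 0) + 1 / (2 * ?m))"
      using m by (intro sum_mono) auto
    also have "\<dots> \<le> 1"
      using m M by (simp add: sum.distrib)
    finally show ?thesis .
  qed
  have "(\<Sum>x\<in>set_pmf p. ?P x * ?r x) \<le> (\<Sum>x\<in>M \<times> snd ` set_pmf p. ?P x * ?r x)"
    using p M m by (intro sum_mono2) (auto simp: rev_image_eqI)
  also have "\<dots> = (\<Sum>y\<in>snd ` set_pmf p. \<Sum>w\<in>M. ?P (w, y) * ?r (w, y))"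
    unfolding sum.cartesian_product' by (rule sum.swap)
  also have "\<dots> = (\<Sum>y\<in>snd ` set_pmf p. pmf (map_pmf snd p) y * (\<Sum>w\<in>M. ?r (w, y)))"
    by (simp add: sum_distrib_left)
  also have "\<dots> \<le> (\<Sum>y\<in>snd ` set_pmf p. pmf (map_pmf snd p) y * 1)"
    by (intro sum_mono mult_left_mono r1) auto
  also have "\<dots> = 1"
    using p by (simp add: sum_pmf_eq_1)
  finally have "ent p \<le> - (\<Sum>x\<in>set_pmf p. pmf p x * log 2 (?P x * ?r x))"
    using P r by (intro gibbs p) (metis mult_pos_pos)
  also have "\<dots> \<le> (\<Sum>x\<in>set_pmf p. - (pmf p x * log 2 (?P x)) + pmf p x +
      pmf p x * (indicator ?err x * log 2 ?m))"
    unfolding sum_negf[symmetric]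
  proof (intro sum_mono)
    fix x assume x: "x \<in> set_pmf p"
    have "log 2 (?P x * ?r x) = log 2 (?P x) + log 2 (?r x)"
      using P[OF x] r[of x] by (subst log_mult) auto
    moreover have "log 2 (?r x) = - 1 - indicator ?err x * log 2 ?m"
      using m by (auto simp: log_divide log_mult split: prod.splits split_indicator)
    ultimately have eq: "log 2 (?P x * ?r x) = log 2 (?P x) - 1 - indicator ?err x * log 2 ?m"
      by linarith
    show "- (pmf p x * log 2 (?P x * ?r x)) \<le>
        - (pmf p x * log 2 (?P x)) + pmf p x + pmf p x * (indicator ?err x * log 2 ?m)"
      unfolding eq by (simp add: right_diff_distrib)
  qed
  also have "\<dots> = ent (map_pmf snd p) + 1 + (\<Sum>x\<in>set_pmf p. pmf p x * indicator ?err x) * log 2 ?m"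
    unfolding sum.distrib ent_def
    using p sum_map_pmf[OF p, of "\<lambda>a. log 2 (pmf (map_pmf snd p) a)" snd]
    by (simp only: sum_distrib_right mult.assoc) (simp add: sum_negf sum_pmf_eq_1)
  also have "(\<Sum>x\<in>set_pmf p. pmf p x * indicator ?err x) = measure_pmf.prob p ?err"
    using p integral_measure_pmf[of "set_pmf p" p "indicator ?err :: _ \<Rightarrow> real"] by simp
  finally show ?thesis .
qed

section \<open>The Gelfand-Pinsker maximum\<close>

text \<open>The weights \<open>q\<close> need not sum to 1: the function is applied to slices of a
  joint law at a fixed value of the auxiliary variable.\<close>

definition out_ent :: "('z::finite \<Rightarrow> 'y::finite pmf) \<Rightarrow> ('z \<Rightarrow> real) \<Rightarrow> real" where
  "out_ent K q = (\<Sum>y\<in>UNIV. eta (\<Sum>z\<in>UNIV. q z * pmf (K z) y))"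

text \<open>With the state as part of z, the pairs (V,Y) and (V,S) are both of this form, S being
  the output of a deterministic channel.\<close>

definition vout :: "('z \<Rightarrow> 'y pmf) \<Rightarrow> ('v \<times> 'z) pmf \<Rightarrow> ('v \<times> 'y) pmf" where
  "vout K Q = bind_pmf Q (\<lambda>(v, z). map_pmf (Pair v) (K z))"

text \<open>\<open>H(Y) - H(S) + H(V,S) - H(V,Y) = I(V;Y) - I(V;S)\<close> when \<open>Y\<close> and \<open>S\<close> are the outputs of
  the channels \<open>K\<close> and \<open>L\<close> with input \<open>z\<close>.\<close>
definition gp_value :: "('z \<Rightarrow> 'y pmf) \<Rightarrow> ('z \<Rightarrow> 's pmf) \<Rightarrow> ('v \<times> 'z) pmf \<Rightarrow> real" where
  "gp_value K L Q = ent (map_pmf snd (vout K Q)) - ent (map_pmf snd (vout L Q))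
     + ent (vout L Q) - ent (vout K Q)"

lemma map_snd_vout: "map_pmf snd (vout K Q) = bind_pmf (map_pmf snd Q) K"
  by (simp add: vout_def map_bind_pmf bind_map_pmf case_prod_unfold pmf.map_comp o_def)

lemma pmf_vout:
  fixes Q :: "('v \<times> 'z::finite) pmf"
  assumes "finite V" "fst ` set_pmf Q \<subseteq> V" "v \<in> V"
  shows "pmf (vout K Q) (v, y) = (\<Sum>z\<in>UNIV. pmf Q (v, z) * pmf (K z) y)"
proof -
  have *: "pmf (map_pmf (Pair v') N) (v, y) = (if v' = v then pmf N y else 0)" for v' N
    by (cases "v' = v") (auto simp: pmf_map_inj' inj_on_def intro!: pmf_map_outside)
  have "pmf (vout K Q) (v, y) =
    (\<Sum>(v', z)\<in>V \<times> UNIV. pmf Q (v', z) * pmf (map_pmf (Pair v') (K z)) (v, y))"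
    unfolding vout_def using assms
    by (subst pmf_bind_sum[of "V \<times> UNIV"]) (auto simp: case_prod_unfold)
  also have "\<dots> = (\<Sum>v'\<in>V. \<Sum>z\<in>UNIV. if v' = v then pmf Q (v', z) * pmf (K z) y else 0)"
    by (simp add: * sum.cartesian_product' if_distrib cong: if_cong)
  also have "\<dots> = (\<Sum>v'\<in>V. if v' = v then \<Sum>z\<in>UNIV. pmf Q (v', z) * pmf (K z) y else 0)"
    by (intro sum.cong) auto
  also have "\<dots> = (\<Sum>z\<in>UNIV. pmf Q (v, z) * pmf (K z) y)"
    using assms by simp
  finally show ?thesis .
qed

text \<open>Grouping the joint masses by the auxiliary value makes the entropy additive over its
  slices, which is what allows a convex hull to describe all auxiliary variables at once.\<close>

lemma ent_vout:
  fixes Q :: "('v \<times> 'z::finite) pmf" and K :: "'z \<Rightarrow> 'y::finite pmf"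
  assumes V: "finite V" "fst ` set_pmf Q \<subseteq> V"
  shows "ent (vout K Q) = (\<Sum>v\<in>V. out_ent K (\<lambda>z. pmf Q (v, z)))"
proof -
  have "ent (vout K Q) = (\<Sum>x\<in>V \<times> UNIV. eta (pmf (vout K Q) x))"
    using V by (intro ent_eq_sum) (auto simp: vout_def image_subset_iff)
  then show ?thesis
    using V by (simp add: sum.cartesian_product' out_ent_def pmf_vout[OF V])
qed

lemma ent_out: "ent (bind_pmf q K) = out_ent K (pmf q)"
  by (simp add: ent_eq_sum[of UNIV] out_ent_def pmf_bind_sum[of UNIV])

lemma sum_out: "(\<Sum>y\<in>UNIV. \<Sum>z\<in>UNIV. q z * pmf (K z) y) = (\<Sum>z\<in>UNIV. q z)"
  for K :: "'z::finite \<Rightarrow> 'y::finite pmf"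
  by (subst sum.swap) (simp add: sum_distrib_left[symmetric] sum_pmf_eq_1)

text \<open>By \<open>eta_mult\<close>. The correction term does not involve the channel, so it
  cancels in a difference of two such entropies.\<close>

lemma out_ent_scale:
  assumes "0 \<le> c" "\<And>z. 0 \<le> q z"
  shows "out_ent K (\<lambda>z. c * q z) = c * out_ent K q + eta c * (\<Sum>z\<in>UNIV. q z)"
proof -
  have "out_ent K (\<lambda>z. c * q z) =
    (\<Sum>y\<in>UNIV. c * eta (\<Sum>z\<in>UNIV. q z * pmf (K z) y) + (\<Sum>z\<in>UNIV. q z * pmf (K z) y) * eta c)"
    unfolding out_ent_def using assms
    by (intro sum.cong refl) (simp add: mult.assoc sum_distrib_left[symmetric] eta_mult sum_nonneg)
  also have "\<dots> = c * out_ent K q + (\<Sum>y\<in>UNIV. \<Sum>z\<in>UNIV. q z * pmf (K z) y) * eta c"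
    by (simp add: sum.distrib out_ent_def sum_distrib_left[symmetric] sum_distrib_right[symmetric])
  finally show ?thesis
    by (simp add: sum_out)
qed

lemma continuous_on_out_ent:
  assumes "A \<subseteq> {q. \<forall>z. 0 \<le> q $ z}"
  shows "continuous_on A (\<lambda>q. out_ent K (\<lambda>z. q $ z))"
  unfolding out_ent_def
proof (intro continuous_on_sum)
  fix y
  show "continuous_on A (\<lambda>q. eta (\<Sum>z\<in>UNIV. q $ z * pmf (K z) y))"
    by (rule continuous_on_compose2[OF continuous_on_eta])
      (use assms in \<open>auto intro!: continuous_intros sum_nonneg\<close>)
qed

section \<open>Compactness and existence of an optimal auxiliary variable\<close>

lemma ex_pmf_finite:
  assumes A: "finite A" and f: "\<And>a. 0 \<le> f a" "sum f A = 1" "\<And>a. a \<notin> A \<Longrightarrow> f a = 0"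
  obtains p where "pmf p = f" "set_pmf p \<subseteq> A"
proof
  have "(\<integral>\<^sup>+ x. ennreal (f x) \<partial>count_space UNIV) = (\<Sum>a\<in>A. ennreal (f a))"
    using A f(3) by (intro nn_integral_count_space') auto
  also have "\<dots> = 1"
    using f by (simp add: sum_ennreal)
  finally have *: "pmf (embed_pmf f) = f"
    using f(1) by (intro ext pmf_embed_pmf)
  then show "pmf (embed_pmf f) = f" .
  show "set_pmf (embed_pmf f) \<subseteq> A"
    using f(3) by (force simp: set_pmf_iff *)
qed

definition prob_simplex :: "(real ^ 'z::finite) set" where
  "prob_simplex = {q. (\<forall>z. 0 \<le> q $ z) \<and> (\<Sum>z\<in>UNIV. q $ z) = 1}"

lemma compact_simplex: "compact prob_simplex"
proof (rule compact_eq_bounded_closed[THEN iffD2, OF conjI])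
  have "norm q \<le> 1" if "q \<in> prob_simplex" for q :: "real ^ 'z"
    using norm_le_l1_cart[of q] that by (simp add: prob_simplex_def)
  then show "bounded (prob_simplex :: (real ^ 'z) set)"
    by (auto simp: bounded_iff)
  have "closed {q :: real ^ 'z. (\<forall>z. 0 \<le> q $ z) \<and> (\<Sum>z\<in>UNIV. q $ z) = 1}"
    by (intro closed_Collect_conj closed_Collect_all closed_Collect_le closed_Collect_eq continuous_intros)
  then show "closed (prob_simplex :: (real ^ 'z) set)"
    by (simp add: prob_simplex_def)
qed

text \<open>The value depends on the auxiliary variable only through the point
  \<open>(P\<^sub>Z, \<Sum>\<^sub>v P(v) \<Phi>(P(\<cdot>|v)))\<close>, \<open>\<Phi>\<close> being the entropy difference of the two outputs. These points
  fill the convex hull of the graph of \<open>\<Phi>\<close> over the simplex, which is compact; this replaces a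
  bound on the alphabet of the auxiliary variable.\<close>
lemma gp_value_attains_max:
  fixes K :: "'z::finite \<Rightarrow> 'y::finite pmf" and L :: "'z \<Rightarrow> 's::finite pmf"
  assumes Q0: "bind_pmf Q0 L = PS"
  obtains Q :: "(nat \<times> 'z) pmf" where "finite (set_pmf Q)" "map_pmf snd (vout L Q) = PS"
    "\<And>Q' :: ('v \<times> 'z) pmf. finite (set_pmf Q') \<Longrightarrow> map_pmf snd (vout L Q') = PS \<Longrightarrow>
       gp_value K L Q' \<le> gp_value K L Q"
proof -
  define \<Phi> where "\<Phi> q = out_ent L q - out_ent K q" for q
  define gr where "gr q = (q, \<Phi> (\<lambda>z. q $ z))" for q :: "real ^ 'z"
  define H where "H = convex hull (gr ` prob_simplex)"
  \<comment> \<open>Prescribing the state law is a linear condition on the law of z, so it cuts a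
    closed slice out of the hull.\<close>
  define C where "C = H \<inter> {x. \<forall>s. (\<Sum>z\<in>UNIV. fst x $ z * pmf (L z) s) = pmf PS s}"
  \<comment> \<open>On \<open>C\<close> the first component is the law of z and the second plays the
    role of H(V,S) - H(V,Y), so this is H(Y) - H(S) + H(V,S) - H(V,Y).\<close>
  define F where "F x = out_ent K (\<lambda>z. fst x $ z) - ent PS + snd x" for x :: "(real ^ 'z) \<times> real"
  have \<Phi>_scale: "\<Phi> (\<lambda>z. c * q z) = c * \<Phi> q" if "0 \<le> c" "\<And>z. 0 \<le> q z" for c q
    using that by (simp add: \<Phi>_def out_ent_scale right_diff_distrib)
  have "continuous_on prob_simplex gr"
    unfolding gr_def \<Phi>_def
    by (intro continuous_intros continuous_on_out_ent) (auto simp: prob_simplex_def)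
  then have "compact H"
    unfolding H_def by (intro compact_convex_hull compact_continuous_image compact_simplex)
  have convex_simplex: "convex (prob_simplex \<times> (UNIV :: real set))"
    by (auto simp: prob_simplex_def convex_def sum.distrib sum_distrib_left[symmetric])
  have H_simplex: "fst x \<in> prob_simplex" if "x \<in> H" for x
  proof -
    have "H \<subseteq> prob_simplex \<times> UNIV"
      unfolding H_def by (rule hull_minimal[where S=convex]) (auto simp: gr_def convex_simplex)
    with that show ?thesis by auto
  qed
  have "closed {x :: (real ^ 'z) \<times> real. \<forall>s. (\<Sum>z\<in>UNIV. fst x $ z * pmf (L z) s) = pmf PS s}"
    by (intro closed_Collect_all closed_Collect_eq continuous_intros)
  with \<open>compact H\<close> have "compact C"
    unfolding C_def by (rule compact_Int_closed)
  have "continuous_on C F"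
    unfolding F_def
    by (intro continuous_intros continuous_on_compose2[OF continuous_on_out_ent[OF order_refl]])
      (use H_simplex in \<open>auto simp: C_def prob_simplex_def\<close>)

  \<comment> \<open>Any alphabet is allowed here: the point is the mixture, with weights P(v), of
    the graph points over the conditional laws of z given v.\<close>
  have point: "\<exists>x\<in>C. F x = gp_value K L Q"
    if fin: "finite (set_pmf Q)" and PS: "map_pmf snd (vout L Q) = PS" for Q :: "('w \<times> 'z) pmf"
  proof -
    define V where "V = fst ` set_pmf Q"
    define u where "u v = (\<Sum>z\<in>UNIV. pmf Q (v, z))" for v
    define q where "q v = (\<chi> z. pmf Q (v, z) / u v)" for v
    have V: "finite V" "fst ` set_pmf Q \<subseteq> V" using fin by (auto simp: V_def)
    have u_pos: "0 < u v" if v: "v \<in> V" for v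
    proof -
      obtain z where "(v, z) \<in> set_pmf Q" using v by (auto simp: V_def)
      then have "0 < pmf Q (v, z)" by (rule pmf_positive)
      then show ?thesis unfolding u_def by (intro sum_pos2[of _ z]) auto
    qed
    have "(\<Sum>v\<in>V. u v) = (\<Sum>x\<in>V \<times> UNIV. pmf Q x)"
      by (simp add: u_def sum.cartesian_product')
    also have "\<dots> = 1"
      using V by (intro sum_pmf_eq_1) (auto simp: image_subset_iff)
    finally have u1: "(\<Sum>v\<in>V. u v) = 1" .
    have q: "q v \<in> prob_simplex" if "v \<in> V" for v
      using u_pos[OF that] by (auto simp: prob_simplex_def q_def sum_divide_distrib[symmetric] u_def)
    have uq: "u v * q v $ z = pmf Q (v, z)" if "v \<in> V" for v z
      using u_pos[OF that] by (simp add: q_def)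
    define x where "x = (\<Sum>v\<in>V. u v *\<^sub>R gr (q v))"
    have "x \<in> H"
      unfolding x_def H_def using V u_pos u1 q
      by (intro convex_sum) (auto intro: hull_inc less_imp_le)
    have fst_x: "fst x $ z = pmf (map_pmf snd Q) z" for z
    proof -
      have "fst x $ z = (\<Sum>v\<in>V. pmf Q (v, z))"
        by (simp add: x_def fst_sum gr_def uq)
      also have "\<dots> = (\<Sum>x\<in>V \<times> UNIV. if snd x = z then pmf Q x else 0)"
        by (simp add: sum.cartesian_product')
      also have "\<dots> = pmf (map_pmf snd Q) z"
        using V by (subst pmf_map_sum[of "V \<times> UNIV"]) (auto simp: image_subset_iff)
      finally show ?thesis .
    qed
    have "snd x = (\<Sum>v\<in>V. u v * \<Phi> (\<lambda>z. q v $ z))"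
      by (simp add: x_def snd_sum gr_def)
    \<comment> \<open>Homogeneity of \<Phi> absorbs the weight P(v), turning the conditional law
      back into a slice of \<open>Q\<close>.\<close>
    also have "\<dots> = (\<Sum>v\<in>V. \<Phi> (\<lambda>z. pmf Q (v, z)))"
      using u_pos q by (intro sum.cong refl) (simp add: \<Phi>_scale[symmetric] less_imp_le prob_simplex_def uq)
    also have "\<dots> = ent (vout L Q) - ent (vout K Q)"
      by (simp add: \<Phi>_def sum_subtractf ent_vout[OF V])
    finally have snd_x: "snd x = ent (vout L Q) - ent (vout K Q)" .
    have "x \<in> C"
      using \<open>x \<in> H\<close> PS[symmetric] by (simp add: C_def fst_x map_snd_vout pmf_bind_sum[of UNIV])
    moreover have "F x = gp_value K L Q"
      by (simp add: F_def fst_x snd_x gp_value_def PS) (simp add: map_snd_vout ent_out)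
    ultimately show ?thesis by blast
  qed

  \<comment> \<open>A constant auxiliary variable on top of \<open>Q0\<close> is admissible.\<close>
  have "C \<noteq> {}"
    using point[of "map_pmf (Pair ()) Q0"] Q0
    by (auto simp: map_snd_vout pmf.map_comp o_def)
  then obtain x where x: "x \<in> C" and max: "\<And>x'. x' \<in> C \<Longrightarrow> F x' \<le> F x"
    using continuous_attains_sup[OF \<open>compact C\<close> _ \<open>continuous_on C F\<close>] by blast
  \<comment> \<open>Conversely, the maximiser is a finite convex combination of graph points, and
    the indices of the combination serve as the values of the auxiliary variable.\<close>
  obtain k u y where u: "\<And>i. i \<in> {1..k} \<Longrightarrow> 0 \<le> u i" and y: "\<And>i. i \<in> {1..k} \<Longrightarrow> y i \<in> gr ` prob_simplex"
    and u1: "sum u {1..k::nat} = 1" and sum_x: "(\<Sum>i\<in>{1..k}. u i *\<^sub>R y i) = x"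
    using x unfolding C_def H_def convex_hull_indexed by blast
  define q where "q i = fst (y i)" for i
  have y_eq: "y i = (q i, \<Phi> (\<lambda>z. q i $ z))" and q: "q i \<in> prob_simplex" if "i \<in> {1..k}" for i
    using y[OF that] by (auto simp: gr_def q_def)
  define f where "f a = (case a of (i, z) \<Rightarrow> if i \<in> {1..k} then u i * q i $ z else 0)" for a
  have f0: "0 \<le> f a" for a
    using u q by (auto simp: f_def prob_simplex_def split: prod.split)
  have f1: "sum f ({1..k} \<times> UNIV) = 1"
    using u1 q by (simp add: f_def sum.cartesian_product' sum_distrib_left[symmetric] prob_simplex_def)
  have f2: "f a = 0" if "a \<notin> {1..k} \<times> UNIV" for a
    using that by (auto simp: f_def split: prod.splits)
  have "finite ({1..k} \<times> (UNIV :: 'z set))" by simp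
  from ex_pmf_finite[OF this f0 f1 f2]
  obtain Q where Q: "pmf Q = f" "set_pmf Q \<subseteq> {1..k} \<times> UNIV" by blast
  have V: "finite {1..k}" "fst ` set_pmf Q \<subseteq> {1..k}" using Q(2) by auto
  have pmf_Q: "pmf Q (i, z) = u i * q i $ z" if "i \<in> {1..k}" for i z
    using that by (simp add: Q f_def)
  have fst_x: "fst x $ z = pmf (map_pmf snd Q) z" for z
  proof -
    have "pmf (map_pmf snd Q) z = (\<Sum>a\<in>{1..k} \<times> UNIV. if snd a = z then pmf Q a else 0)"
      using Q(2) by (intro pmf_map_sum) auto
    also have "\<dots> = (\<Sum>i\<in>{1..k}. u i * q i $ z)"
      by (simp add: sum.cartesian_product' pmf_Q del: One_nat_def)
    also have "\<dots> = fst x $ z"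
      by (simp add: sum_x[symmetric] fst_sum q_def)
    finally show ?thesis ..
  qed
  have "snd x = (\<Sum>i\<in>{1..k}. u i * \<Phi> (\<lambda>z. q i $ z))"
    by (simp add: sum_x[symmetric] snd_sum y_eq)
  also have "\<dots> = (\<Sum>i\<in>{1..k}. \<Phi> (\<lambda>z. pmf Q (i, z)))"
    using u q by (intro sum.cong refl) (simp add: \<Phi>_scale[symmetric] prob_simplex_def pmf_Q)
  also have "\<dots> = ent (vout L Q) - ent (vout K Q)"
    by (simp add: \<Phi>_def sum_subtractf ent_vout[OF V])
  finally have snd_x: "snd x = ent (vout L Q) - ent (vout K Q)" .
  have PS: "map_pmf snd (vout L Q) = PS"
    using x by (intro pmf_eqI) (simp add: C_def fst_x map_snd_vout pmf_bind_sum[of UNIV])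
  have F_x: "F x = gp_value K L Q"
    by (simp add: F_def fst_x snd_x gp_value_def PS) (simp add: map_snd_vout ent_out)
  show ?thesis
  proof
    show "finite (set_pmf Q)"
      using Q(2) by (rule finite_subset) simp
    show "map_pmf snd (vout L Q) = PS" by (rule PS)
    fix Q' :: "('v \<times> 'z) pmf"
    assume "finite (set_pmf Q')" "map_pmf snd (vout L Q') = PS"
    then obtain x' where "x' \<in> C" "F x' = gp_value K L Q'"
      using point[of Q'] by blast
    then show "gp_value K L Q' \<le> gp_value K L Q"
      using max[of x'] F_x by simp
  qed
qed

section \<open>Time sharing\<close>

lemma ent_share_both:
  assumes "inj f" and "finite (set_pmf N)"
  shows "ent (map_pmf f (pair_pmf (bernoulli_pmf l) N)) = ent (bernoulli_pmf l) + ent N"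
  using assms
  by (subst ent_map_inj) (auto simp: ent_pair_pmf intro: inj_on_subset)

text \<open>The label is 0 exactly when the bit is \<open>b\<close>, so it reveals the bit; it hides
  the auxiliary value in that case and determines it in the other. Conditioning on the bit gives the
  formula.\<close>

lemma ent_share_one:
  fixes N :: "('v \<times> 'c) pmf" and h :: "bool \<Rightarrow> 'v \<Rightarrow> nat"
  assumes N: "finite (set_pmf N)" and l: "0 \<le> l" "l \<le> 1"
    and h: "\<And>v. h b v = 0" "\<And>v. h (\<not> b) v \<noteq> 0" "inj (h (\<not> b))"
  shows "ent (map_pmf (\<lambda>(b, v, c). (c, h b v)) (pair_pmf (bernoulli_pmf l) N)) =
    ent (bernoulli_pmf l) + pmf (bernoulli_pmf l) b * ent (map_pmf snd N)
      + pmf (bernoulli_pmf l) (\<not> b) * ent N"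
proof -
  let ?B = "bernoulli_pmf l" and ?M = "\<lambda>b. map_pmf (\<lambda>(v, c). (c, h b v)) N"
  have fB: "finite (set_pmf ?B)" by simp
  have "ent (bind_pmf ?B (\<lambda>b. map_pmf (Pair b) (?M b))) =
      ent ?B + (\<Sum>b\<in>set_pmf ?B. pmf ?B b * ent (?M b))"
    using N fB by (intro ent_bind_Pair) auto
  also have "(\<Sum>b\<in>set_pmf ?B. pmf ?B b * ent (?M b)) = (\<Sum>b\<in>UNIV. pmf ?B b * ent (?M b))"
    by (intro sum.mono_neutral_left) (auto simp: set_pmf_iff)
  also have "\<dots> = (\<Sum>b\<in>{b, \<not> b}. pmf ?B b * ent (?M b))"
    by (intro sum.cong) auto
  also have "\<dots> = pmf ?B b * ent (?M b) + pmf ?B (\<not> b) * ent (?M (\<not> b))"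
    by simp
  also have "ent (?M (\<not> b)) = ent N"
    using h(3) by (intro ent_map_inj) (auto simp: inj_on_def)
  also have "?M b = map_pmf (\<lambda>c. (c, 0)) (map_pmf snd N)"
    using h(1) by (simp add: pmf.map_comp o_def case_prod_unfold)
  also have "ent \<dots> = ent (map_pmf snd N)"
    by (intro ent_map_inj) (auto simp: inj_on_def)
  finally have "ent (bind_pmf ?B (\<lambda>b. map_pmf (Pair b) (?M b))) =
      ent ?B + pmf ?B b * ent (map_pmf snd N) + pmf ?B (\<not> b) * ent N" by simp
  moreover have "map_pmf (\<lambda>(b, v, c). (c, h b v)) (pair_pmf ?B N) =
      map_pmf snd (bind_pmf ?B (\<lambda>b. map_pmf (Pair b) (?M b)))"
    by (simp add: pair_pmf_eq_bind map_bind_pmf pmf.map_comp o_def case_prod_unfold)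
  moreover have "ent (map_pmf snd (bind_pmf ?B (\<lambda>b. map_pmf (Pair b) (?M b)))) =
      ent (bind_pmf ?B (\<lambda>b. map_pmf (Pair b) (?M b)))"
  proof (intro ent_map_inj inj_onI)
    fix x y
    assume x: "x \<in> set_pmf (bind_pmf ?B (\<lambda>b. map_pmf (Pair b) (?M b)))"
      and y: "y \<in> set_pmf (bind_pmf ?B (\<lambda>b. map_pmf (Pair b) (?M b)))" and eq: "snd x = snd y"
    from x y have "\<exists>v. snd (snd x) = h (fst x) v" "\<exists>v. snd (snd y) = h (fst y) v"
      by auto
    \<comment> \<open>The bit can be read off the label, so forgetting the bit is injective on the
      support.\<close>
    moreover have "h a v = 0 \<longleftrightarrow> a = b" for a v
      using h(1,2)[of v] by (cases a; cases b) auto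
    ultimately have "fst x = b \<longleftrightarrow> fst y = b"
      using eq by metis
    then show "x = y"
      using eq by (intro prod_eqI) auto
  qed
  ultimately show ?thesis by simp
qed

section \<open>From an optimal joint law to the outer region\<close>

text \<open>Disintegration along the state: it recovers from a joint law the conditional law that
  \<open>joint\<close> takes as its argument.\<close>

lemma bind_cond_pmf_fst:
  fixes T :: "('s \<times> 'a) pmf"
  assumes "map_pmf fst T = PS"
  shows "bind_pmf PS (\<lambda>s. map_pmf (Pair s) (map_pmf snd (cond_pmf T {t. fst t = s}))) = T"
proof -
  have ne: "set_pmf T \<inter> {t. fst t = s} \<noteq> {}" if "s \<in> set_pmf PS" for s
    using that assms by auto
  have "bind_pmf PS (\<lambda>s. map_pmf (Pair s) (map_pmf snd (cond_pmf T {t. fst t = s}))) =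
      bind_pmf PS (\<lambda>s. cond_pmf T {t. fst t = s})"
  proof (intro bind_pmf_cong refl)
    fix s assume "s \<in> set_pmf PS"
    then have "map_pmf (\<lambda>t. (s, snd t)) (cond_pmf T {t. fst t = s}) =
        map_pmf (\<lambda>t. t) (cond_pmf T {t. fst t = s})"
      using ne by (intro map_pmf_cong) auto
    then show "map_pmf (Pair s) (map_pmf snd (cond_pmf T {t. fst t = s})) =
        cond_pmf T {t. fst t = s}"
      by (simp add: pmf.map_comp o_def)
  qed
  also have "\<dots> = T"
  proof (rule bind_cond_pmf_cancel[where R = "\<lambda>s t. fst t = s"])
    show "set_pmf T \<inter> {t. fst t = s} \<noteq> {}" if "s \<in> set_pmf PS" for s
      by (rule ne[OF that])
    show "set_pmf PS \<inter> {s. fst t = s} \<noteq> {}" if "t \<in> set_pmf T" for t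
      using that assms by auto
    show "measure_pmf.prob T {t'. fst t' = s} = measure_pmf.prob PS {s. fst t = s}"
      if "s \<in> set_pmf PS" "t \<in> set_pmf T" "fst t = s" for s t
    proof -
      have "{s. fst t = s} = {s}" using that by auto
      moreover have "{t' :: 's \<times> 'a. fst t' = s} = fst -` {s}" by auto
      ultimately show ?thesis
        by (simp add: assms[symmetric])
    qed
  qed
  finally show ?thesis .
qed

text \<open>The state is made part of the input, so that the two-user channel becomes a single
  channel with input z = (s, x1, x2).\<close>

definition mac :: "('x1 \<Rightarrow> 'x2 \<Rightarrow> 's \<Rightarrow> 'y pmf) \<Rightarrow> 's \<times> 'x1 \<times> 'x2 \<Rightarrow> 'y pmf" where
  "mac W = (\<lambda>(s, x1, x2). W x1 x2 s)"

abbreviation state :: "'s \<times> 'a \<Rightarrow> 's pmf" where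
  "state \<equiv> \<lambda>z. return_pmf (fst z)"

text \<open>The conditional law \<open>P(v\<^sub>1,v\<^sub>2,x\<^sub>1,x\<^sub>2|s)\<close> is unrestricted, so a single Gelfand-Pinsker
  auxiliary variable \<open>V\<close> can be given to either user. An independent time-sharing bit is
  visible in both auxiliaries: when it is \<open>True\<close>, \<open>(V\<^sub>1, V\<^sub>2) = (V + 1, 0)\<close>, otherwise
  \<open>(V\<^sub>1, V\<^sub>2) = (0, V + 1)\<close>.\<close>
lemma outer_regionI:
  fixes PS :: "'s::finite pmf"
    and W :: "'x1::finite \<Rightarrow> 'x2::finite \<Rightarrow> 's \<Rightarrow> 'y::finite pmf"
    and Q :: "(nat \<times> 's \<times> 'x1 \<times> 'x2) pmf"
  assumes Q: "finite (set_pmf Q)" and PS: "map_pmf snd (vout state Q) = PS"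
    and l: "0 \<le> l" "l \<le> 1"
    and R1: "R1 \<le> l * gp_value (mac W) state Q"
    and R2: "R2 \<le> (1 - l) * gp_value (mac W) state Q"
  shows "(R1, R2) \<in> outer_region PS W"
proof -
  define i1 :: "bool \<Rightarrow> nat \<Rightarrow> nat" where "i1 b v = (if b then Suc v else 0)" for b v
  define i2 :: "bool \<Rightarrow> nat \<Rightarrow> nat" where "i2 b v = (if b then 0 else Suc v)" for b v
  let ?B = "bernoulli_pmf l"
  define T where "T = map_pmf (\<lambda>(b, v, s, x). (s, i1 b v, i2 b v, x)) (pair_pmf ?B Q)"
  \<comment> \<open>Off the support of \<open>PS\<close> the conditional law is unspecified; a point
    mass keeps every support finite, as the outer region demands.\<close>
  define P where "P s = (if s \<in> set_pmf PS then map_pmf snd (cond_pmf T {t. fst t = s})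
    else return_pmf undefined)" for s
  \<comment> \<open>The law of (V, Z, Y) without time sharing; together with the bit it yields
    \<open>J\<close>, (V,Y) and (V,S) as images.\<close>
  define G where "G = bind_pmf Q (\<lambda>(v, z). map_pmf (\<lambda>y. (v, z, y)) (mac W z))"
  define J where "J = joint PS W P"
  define C where "C = gp_value (mac W) state Q"
  let ?K = "vout (mac W) Q" and ?L = "vout state Q"
  have "map_pmf fst T = map_pmf (\<lambda>(v, z). fst z) (map_pmf snd (pair_pmf ?B Q))"
    by (simp add: T_def pmf.map_comp o_def case_prod_unfold)
  also have "\<dots> = PS"
    using PS by (simp add: map_snd_pair_pmf map_snd_vout case_prod_unfold
        map_pmf_def[symmetric] pmf.map_comp o_def)
  finally have T: "map_pmf fst T = PS" .
  have fT: "finite (set_pmf T)"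
    using Q by (auto simp: T_def)
  have "bind_pmf PS (\<lambda>s. map_pmf (Pair s) (P s)) =
      bind_pmf PS (\<lambda>s. map_pmf (Pair s) (map_pmf snd (cond_pmf T {t. fst t = s})))"
    by (intro bind_pmf_cong) (auto simp: P_def)
  then have T_eq: "bind_pmf PS (\<lambda>s. map_pmf (Pair s) (P s)) = T"
    using bind_cond_pmf_fst[OF T] by simp
  have fP: "finite (set_pmf (P s))" for s
  proof (cases "s \<in> set_pmf PS")
    case True
    then have "set_pmf T \<inter> {t. fst t = s} \<noteq> {}" using T by auto
    with True fT show ?thesis by (simp add: P_def)
  qed (simp add: P_def)
  have "J = bind_pmf (bind_pmf PS (\<lambda>s. map_pmf (Pair s) (P s)))
      (\<lambda>(s, v1, v2, x1, x2). map_pmf (\<lambda>y. (s, v1, v2, x1, x2, y)) (W x1 x2 s))"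
    by (simp add: J_def joint_def bind_assoc_pmf bind_map_pmf case_prod_unfold)
  also note T_eq
  also have "bind_pmf T
      (\<lambda>(s, v1, v2, x1, x2). map_pmf (\<lambda>y. (s, v1, v2, x1, x2, y)) (W x1 x2 s)) =
      map_pmf (\<lambda>(b, v, (s, x1, x2), y). (s, i1 b v, i2 b v, x1, x2, y)) (pair_pmf ?B G)"
    by (simp add: T_def G_def pair_pmf_def mac_def bind_map_pmf map_bind_pmf bind_assoc_pmf
        bind_return_pmf map_pmf_def case_prod_unfold)
  finally have J: "J = map_pmf (\<lambda>(b, v, (s, x1, x2), y). (s, i1 b v, i2 b v, x1, x2, y)) (pair_pmf ?B G)" .
  have K: "pair_pmf ?B ?K = map_pmf (\<lambda>(b, v, z, y). (b, v, y)) (pair_pmf ?B G)"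
    by (simp add: pair_pmf_def G_def vout_def bind_map_pmf map_bind_pmf bind_assoc_pmf
        bind_return_pmf map_pmf_def case_prod_unfold)
  have L: "pair_pmf ?B ?L = map_pmf (\<lambda>(b, v, z, y). (b, v, fst z)) (pair_pmf ?B G)"
    by (simp add: pair_pmf_def G_def vout_def bind_map_pmf map_bind_pmf bind_assoc_pmf
        bind_return_pmf map_pmf_def case_prod_unfold)
  have KJ: "map_pmf (\<lambda>(s, v1, v2, x1, x2, y). f v1 v2 y) J =
      map_pmf (\<lambda>(b, v, y). f (i1 b v) (i2 b v) y) (pair_pmf ?B ?K)" for f :: "nat \<Rightarrow> nat \<Rightarrow> 'y \<Rightarrow> 'c"
    by (simp add: J K pmf.map_comp o_def case_prod_unfold)
  have LJ: "map_pmf (\<lambda>(s, v1, v2, x1, x2, y). f v1 v2 s) J =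
      map_pmf (\<lambda>(b, v, s). f (i1 b v) (i2 b v) s) (pair_pmf ?B ?L)" for f :: "nat \<Rightarrow> nat \<Rightarrow> 's \<Rightarrow> 'c"
    by (simp add: J L pmf.map_comp o_def case_prod_unfold)
  have fK: "finite (set_pmf ?K)" and fL: "finite (set_pmf ?L)"
    using Q by (auto simp: vout_def)
  \<comment> \<open>Exactly one of the two labels is nonzero; which one tells the bit, and its
    predecessor is V.\<close>
  have i_inj: "i1 b v = i1 b' v' \<Longrightarrow> i2 b v = i2 b' v' \<Longrightarrow> b = b' \<and> v = v'" for b b' v v'
    by (auto simp: i1_def i2_def split: if_splits)
  have inj_0: "ent (map_pmf (\<lambda>(b, v, c). ((i1 b v, i2 b v), c)) (pair_pmf ?B N)) = ent ?B + ent N"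
    if "finite (set_pmf N)" for N :: "(nat \<times> 'c) pmf"
    by (rule ent_share_both[OF _ that]) (auto simp: inj_def dest: i_inj)
  have inj_1: "ent (map_pmf (\<lambda>(b, v, c). (i2 b v, c, i1 b v)) (pair_pmf ?B N)) = ent ?B + ent N"
    if "finite (set_pmf N)" for N :: "(nat \<times> 'c) pmf"
    by (rule ent_share_both[OF _ that]) (auto simp: inj_def dest: i_inj)
  have inj_2: "ent (map_pmf (\<lambda>(b, v, c). (i1 b v, c, i2 b v)) (pair_pmf ?B N)) = ent ?B + ent N"
    if "finite (set_pmf N)" for N :: "(nat \<times> 'c) pmf"
    by (rule ent_share_both[OF _ that]) (auto simp: inj_def dest: i_inj)
  have share0: "map_pmf (\<lambda>(b, v, c). c) (pair_pmf ?B N) = map_pmf snd N"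
    for N :: "(nat \<times> 'c) pmf"
  proof -
    have "map_pmf (\<lambda>(b, v, c). c) (pair_pmf ?B N) = map_pmf snd (map_pmf snd (pair_pmf ?B N))"
      by (simp add: pmf.map_comp o_def case_prod_unfold)
    then show ?thesis
      by (simp add: map_snd_pair_pmf)
  qed
  \<comment> \<open>The second label hides V when the bit is \<open>True\<close>, which has
    probability \<open>l\<close>.\<close>
  have share2: "ent (map_pmf (\<lambda>(b, v, c). (c, i2 b v)) (pair_pmf ?B N)) =
      ent ?B + l * ent (map_pmf snd N) + (1 - l) * ent N"
    if "finite (set_pmf N)" for N :: "(nat \<times> 'c) pmf"
    using that l ent_share_one[of N l i2 True] by (simp add: i2_def inj_def)
  have share1: "ent (map_pmf (\<lambda>(b, v, c). (c, i1 b v)) (pair_pmf ?B N)) =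
      ent ?B + (1 - l) * ent (map_pmf snd N) + l * ent N"
    if "finite (set_pmf N)" for N :: "(nat \<times> 'c) pmf"
    using that l ent_share_one[of N l i1 False] by (simp add: i1_def inj_def)

  have "cmi (map_pmf (\<lambda>(s,v1,v2,x1,x2,y). (v1, y, v2)) J)
      - cmi (map_pmf (\<lambda>(s,v1,v2,x1,x2,y). (v1, s, v2)) J) =
    ent (map_pmf (\<lambda>(s,v1,v2,x1,x2,y). (y, v2)) J) - ent (map_pmf (\<lambda>(s,v1,v2,x1,x2,y). (v1, y, v2)) J)
    - ent (map_pmf (\<lambda>(s,v1,v2,x1,x2,y). (s, v2)) J) + ent (map_pmf (\<lambda>(s,v1,v2,x1,x2,y). (v1, s, v2)) J)"
    by (simp add: cmi_def pmf.map_comp o_def case_prod_unfold)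
  \<comment> \<open>The entropy of the bit cancels, and only the branch in which the first label
    carries V contributes.\<close>
  also have "\<dots> = l * C"
    unfolding KJ LJ share2[OF fK] share2[OF fL] inj_2[OF fK] inj_2[OF fL]
    by (simp add: C_def gp_value_def algebra_simps)
  finally have 1: "cmi (map_pmf (\<lambda>(s,v1,v2,x1,x2,y). (v1, y, v2)) J)
      - cmi (map_pmf (\<lambda>(s,v1,v2,x1,x2,y). (v1, s, v2)) J) = l * C" .

  have "cmi (map_pmf (\<lambda>(s,v1,v2,x1,x2,y). (v2, y, v1)) J)
      - cmi (map_pmf (\<lambda>(s,v1,v2,x1,x2,y). (v2, s, v1)) J) =
    ent (map_pmf (\<lambda>(s,v1,v2,x1,x2,y). (y, v1)) J) - ent (map_pmf (\<lambda>(s,v1,v2,x1,x2,y). (v2, y, v1)) J)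
    - ent (map_pmf (\<lambda>(s,v1,v2,x1,x2,y). (s, v1)) J) + ent (map_pmf (\<lambda>(s,v1,v2,x1,x2,y). (v2, s, v1)) J)"
    by (simp add: cmi_def pmf.map_comp o_def case_prod_unfold)
  also have "\<dots> = (1 - l) * C"
    unfolding KJ LJ share1[OF fK] share1[OF fL] inj_1[OF fK] inj_1[OF fL]
    by (simp add: C_def gp_value_def algebra_simps)
  finally have 2: "cmi (map_pmf (\<lambda>(s,v1,v2,x1,x2,y). (v2, y, v1)) J)
      - cmi (map_pmf (\<lambda>(s,v1,v2,x1,x2,y). (v2, s, v1)) J) = (1 - l) * C" .

  have "mi (map_pmf (\<lambda>(s,v1,v2,x1,x2,y). ((v1, v2), y)) J)
      - mi (map_pmf (\<lambda>(s,v1,v2,x1,x2,y). ((v1, v2), s)) J) =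
    ent (map_pmf (\<lambda>(s,v1,v2,x1,x2,y). y) J) - ent (map_pmf (\<lambda>(s,v1,v2,x1,x2,y). ((v1, v2), y)) J)
    - ent (map_pmf (\<lambda>(s,v1,v2,x1,x2,y). s) J) + ent (map_pmf (\<lambda>(s,v1,v2,x1,x2,y). ((v1, v2), s)) J)"
    by (simp add: mi_def pmf.map_comp o_def case_prod_unfold)
  also have "\<dots> = ent (map_pmf (\<lambda>(b, v, y). y) (pair_pmf ?B ?K)) - ent (map_pmf (\<lambda>(b, v, y). y) (pair_pmf ?B ?L))
    + ent ?L - ent ?K"
    unfolding KJ LJ inj_0[OF fK] inj_0[OF fL] by simp
  also have "\<dots> = C"
    unfolding share0 by (simp add: C_def gp_value_def)
  finally have 3: "mi (map_pmf (\<lambda>(s,v1,v2,x1,x2,y). ((v1, v2), y)) J)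
      - mi (map_pmf (\<lambda>(s,v1,v2,x1,x2,y). ((v1, v2), s)) J) = C" .

  have "R1 + R2 \<le> C"
    using R1 R2 by (simp add: C_def algebra_simps)
  with fP R1 R2 show ?thesis
    unfolding outer_region_def Let_def mem_Collect_eq case_prod_conv
    by (intro exI[of _ P]) (simp only: J_def[symmetric] C_def[symmetric] 1 2 3 simp_thms)
qed

section \<open>The converse\<close>

lemma replicate_pmf_Suc_pair:
  "replicate_pmf (Suc n) p = map_pmf (\<lambda>(x, xs). x # xs) (pair_pmf p (replicate_pmf n p))"
  by (simp add: pair_pmf_def map_bind_pmf)

lemma finite_replicate_pmf: "finite (set_pmf p) \<Longrightarrow> finite (set_pmf (replicate_pmf n p))"
  by (induction n) auto

lemma ent_replicate_pmf:
  "finite (set_pmf p) \<Longrightarrow> ent (replicate_pmf n p) = real n * ent p"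
proof (induction n)
  case (Suc n)
  have "ent (replicate_pmf (Suc n) p) = ent (pair_pmf p (replicate_pmf n p))"
    unfolding replicate_pmf_Suc_pair by (intro ent_map_inj) (auto simp: inj_on_def)
  with Suc show ?case
    by (simp add: ent_pair_pmf finite_replicate_pmf distrib_right del: replicate_pmf.simps)
qed simp

lemma pmf_replicate_pmf:
  "pmf (replicate_pmf n p) xs = (if length xs = n then \<Prod>k<n. pmf p (xs ! k) else 0)"
proof (induction n arbitrary: xs)
  case (Suc n)
  show ?case
  proof (cases xs)
    case Nil
    then show ?thesis
      by (auto simp: pmf_eq_0_set_pmf)
  next
    case (Cons x ys)
    have "pmf (replicate_pmf (Suc n) p) ((\<lambda>(x, xs). x # xs) (x, ys)) =
        pmf (pair_pmf p (replicate_pmf n p)) (x, ys)"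
      unfolding replicate_pmf_Suc_pair by (intro pmf_map_inj') (auto simp: inj_def)
    then show ?thesis
      using Suc Cons by (simp add: pmf_pair prod.lessThan_Suc_shift del: replicate_pmf.simps prod.lessThan_Suc)
  qed
qed (simp add: indicator_def)

lemma map_nth_replicate_pmf: "k < n \<Longrightarrow> map_pmf (\<lambda>xs. xs ! k) (replicate_pmf n p) = p"
proof (induction n arbitrary: k)
  case (Suc n)
  show ?case
  proof (cases k)
    case 0
    then show ?thesis
      unfolding replicate_pmf_Suc_pair
      by (simp add: pmf.map_comp o_def case_prod_unfold map_fst_pair_pmf)
  next
    case (Suc j)
    have "map_pmf (\<lambda>xs. xs ! k) (replicate_pmf (Suc n) p) =
        map_pmf (\<lambda>xs. xs ! j) (map_pmf snd (pair_pmf p (replicate_pmf n p)))"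
      unfolding replicate_pmf_Suc_pair Suc
      by (simp add: pmf.map_comp o_def case_prod_unfold)
    with Suc Suc.IH[of j] Suc.prems show ?thesis
      by (simp add: map_snd_pair_pmf)
  qed
qed simp

section \<open>Laws of output sequences under feedback\<close>

text \<open>Message and states are frozen in \<open>e\<close>. Outputs are appended at the end, so
  the argument of \<open>e k\<close> is the prefix that \<open>pe\<close> writes as
  \<open>take k y\<close>.\<close>

primrec fb_out :: "('z \<Rightarrow> 'y pmf) \<Rightarrow> (nat \<Rightarrow> 'y list \<Rightarrow> 'z) \<Rightarrow> nat \<Rightarrow> 'y list pmf" where
  "fb_out K e 0 = return_pmf []"
| "fb_out K e (Suc k) = bind_pmf (fb_out K e k) (\<lambda>y. map_pmf (\<lambda>a. y @ [a]) (K (e k y)))"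

lemma length_fb_out: "y \<in> set_pmf (fb_out K e n) \<Longrightarrow> length y = n"
  by (induction n arbitrary: y) auto

lemma finite_fb_out: "finite (set_pmf (fb_out K e n))" for K :: "'z \<Rightarrow> 'y::finite pmf"
  by (induction n) (auto intro:)

lemma pmf_fb_out:
  fixes K :: "'z \<Rightarrow> 'y::finite pmf"
  shows "pmf (fb_out K e n) y =
    (if length y = n then \<Prod>k<n. pmf (K (e k (take k y))) (y ! k) else 0)"
proof (induction n arbitrary: y)
  case (Suc n)
  show ?case
  proof (cases "length y = Suc n")
    case False
    then show ?thesis
      using length_fb_out[of y K e "Suc n"] by (auto simp: pmf_eq_0_set_pmf simp del: fb_out.simps)
  next
    case True
    then obtain x a where y: "y = x @ [a]" and x: "length x = n"
      by (metis length_Suc_conv_rev)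
    have "fb_out K e (Suc n) = map_pmf (\<lambda>(x, a). x @ [a])
        (bind_pmf (fb_out K e n) (\<lambda>x. map_pmf (Pair x) (K (e n x))))"
      by (simp add: map_bind_pmf pmf.map_comp o_def)
    then have "pmf (fb_out K e (Suc n)) ((\<lambda>(x, a). x @ [a]) (x, a)) =
        pmf (bind_pmf (fb_out K e n) (\<lambda>x. map_pmf (Pair x) (K (e n x)))) (x, a)"
      by (simp only: pmf_map_inj' inj_def) (intro pmf_map_inj', auto simp: inj_def)
    also have "\<dots> = pmf (fb_out K e n) x * pmf (K (e n x)) a"
      by (rule pmf_bind_Pair[OF finite_fb_out])
    also have "\<dots> = (\<Prod>k<Suc n. pmf (K (e k (take k y))) (y ! k))"
      using x by (simp add: Suc y nth_append)
    finally show ?thesis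
      using True y by simp
  qed
qed (simp add: indicator_def)

definition transcript ::
  "('z \<Rightarrow> 'y pmf) \<Rightarrow> (nat \<Rightarrow> 'm \<Rightarrow> 'y list \<Rightarrow> 'z) \<Rightarrow> 'm pmf \<Rightarrow> nat \<Rightarrow> ('m \<times> 'y list) pmf" where
  "transcript K e M n = bind_pmf M (\<lambda>m. map_pmf (Pair m) (fb_out K (\<lambda>k. e k m) n))"

lemma transcript_Suc:
  "transcript K e M (Suc n) =
    bind_pmf (transcript K e M n) (\<lambda>(m, y). map_pmf (\<lambda>a. (m, y @ [a])) (K (e n m y)))"
  by (simp add: transcript_def bind_assoc_pmf bind_map_pmf map_bind_pmf pmf.map_comp o_def)

lemma map_fst_transcript: "map_pmf fst (transcript K e M n) = M"
  by (simp add: transcript_def map_bind_pmf pmf.map_comp o_def map_pmf_const bind_return_pmf')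

lemma finite_transcript:
  fixes K :: "'z \<Rightarrow> 'y::finite pmf"
  shows "finite (set_pmf M) \<Longrightarrow> finite (set_pmf (transcript K e M n))"
  by (simp add: transcript_def finite_fb_out)

text \<open>Times start at \<open>0\<close> and \<open>Y\<^sup>k\<close> is the list of the first \<open>k\<close> outputs. With
  \<open>V\<^sub>k = (W, Y\<^sup>k, S\<^sub>k\<^sub>+\<^sub>1, \<dots>, S\<^sub>n\<^sub>-\<^sub>1)\<close>, both \<open>H(V\<^sub>k, S\<^sub>k)\<close> and \<open>H(V\<^sub>k\<^sub>-\<^sub>1, Y\<^sub>k\<^sub>-\<^sub>1)\<close> are the
  entropy of \<open>(W, Y\<^sup>k, S\<^sub>k, \<dots>, S\<^sub>n\<^sub>-\<^sub>1)\<close>, so the single-letter values telescope.\<close>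
lemma converse_telescope:
  fixes K :: "'s::finite \<times> 'x::finite \<Rightarrow> 'y::finite pmf"
    and e :: "nat \<Rightarrow> 'w \<times> 's list \<Rightarrow> 'y list \<Rightarrow> 's \<times> 'x"
  assumes M: "M = pair_pmf N (replicate_pmf n PS)" and N: "finite (set_pmf N)"
    and e: "\<And>k w s y. fst (e k (w, s) y) = s ! k"
    and C: "\<And>Q :: (('w \<times> 'y list \<times> 's list) \<times> 's \<times> 'x) pmf. finite (set_pmf Q) \<Longrightarrow>
      map_pmf snd (vout state Q) = PS \<Longrightarrow> gp_value K state Q \<le> C"
    and k: "k \<le> n"
  shows "ent (map_pmf snd (transcript K e M k))
      - ent (map_pmf (\<lambda>((w, s), y). (w, y, drop k s)) (transcript K e M k))
      \<le> real k * (C + ent PS) - ent M"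
  using k
proof (induction k)
  case 0
  have "ent (map_pmf snd (transcript K e M 0)) = 0"
    by (simp add: transcript_def map_bind_pmf)
  moreover have "ent (map_pmf (\<lambda>((w, s), y). (w, y, drop 0 s)) (transcript K e M 0)) =
      ent (map_pmf (\<lambda>(w, s). (w, [] :: 'y list, s)) M)"
    by (simp add: transcript_def bind_assoc_pmf bind_return_pmf map_pmf_def case_prod_unfold)
  moreover have "\<dots> = ent M"
    by (intro ent_map_inj) (auto simp: inj_on_def)
  ultimately show ?case by simp
next
  case (Suc k)
  let ?T = "transcript K e M k" and ?T' = "transcript K e M (Suc k)"
  define Q where "Q = map_pmf (\<lambda>((w, s), y). ((w, y, drop (Suc k) s), e k (w, s) y)) ?T"
  have fM: "finite (set_pmf M)"
    using N by (simp add: M finite_replicate_pmf)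
  then have fT: "finite (set_pmf ?T)"
    by (rule finite_transcript)
  then have fQ: "finite (set_pmf Q)" by (simp add: Q_def)
  have fK: "finite (set_pmf (vout K Q))"
    using fQ by (auto simp: vout_def intro:)
  have len: "length s = n" if "((w, s), y) \<in> set_pmf ?T" for w s y
  proof -
    have "fst ((w, s), y) \<in> set_pmf (map_pmf fst ?T)"
      using that by (simp only: set_map_pmf imageI)
    then show ?thesis
      by (simp add: map_fst_transcript M set_replicate_pmf)
  qed
  have L: "vout state Q = map_pmf (\<lambda>((w, s), y). ((w, y, drop (Suc k) s), s ! k)) ?T"
    using e[of k "fst m" "snd m" for m]
    by (simp add: vout_def Q_def bind_map_pmf map_pmf_def bind_return_pmf bind_assoc_pmf case_prod_unfold)
  \<comment> \<open>Feedback leaves the joint law of message and states unchanged, so the current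
    state still has law \<open>PS\<close> and \<open>Q\<close> is admissible.\<close>
  have "map_pmf snd (vout state Q) = map_pmf (\<lambda>s. s ! k) (map_pmf snd (map_pmf fst ?T))"
    by (simp add: L pmf.map_comp o_def case_prod_unfold)
  then have PS: "map_pmf snd (vout state Q) = PS"
    using Suc.prems by (simp add: map_fst_transcript M map_snd_pair_pmf map_nth_replicate_pmf)
  \<comment> \<open>Putting the current state in front of the future ones gives the tail starting at
    time \<open>k\<close>.\<close>
  have "ent (vout state Q) = ent (map_pmf (\<lambda>((w, y, s), a). (w, y, a # s)) (vout state Q))"
    by (intro ent_map_inj[symmetric]) (auto simp: inj_on_def)
  also have "map_pmf (\<lambda>((w, y, s), a). (w, y, a # s)) (vout state Q) =
      map_pmf (\<lambda>((w, s), y). (w, y, drop k s)) ?T"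
    unfolding L pmf.map_comp
    using Suc.prems by (intro map_pmf_cong) (auto simp: len Cons_nth_drop_Suc)
  finally have HL: "ent (vout state Q) = ent (map_pmf (\<lambda>((w, s), y). (w, y, drop k s)) ?T)" .
  have "ent (vout K Q) = ent (map_pmf (\<lambda>((w, y, s), a). (w, y @ [a], s)) (vout K Q))"
    by (intro ent_map_inj[symmetric]) (auto simp: inj_on_def)
  also have "map_pmf (\<lambda>((w, y, s), a). (w, y @ [a], s)) (vout K Q) =
      map_pmf (\<lambda>((w, s), y). (w, y, drop (Suc k) s)) ?T'"
    by (simp add: transcript_Suc vout_def Q_def bind_map_pmf map_bind_pmf pmf.map_comp o_def
        case_prod_unfold)
  finally have HK: "ent (vout K Q) = ent (map_pmf (\<lambda>((w, s), y). (w, y, drop (Suc k) s)) ?T')" .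
  \<comment> \<open>The law of the past outputs and the current one; subadditivity of its entropy is
    the loss incurred by single-letterising the output.\<close>
  define p where "p = map_pmf (\<lambda>((w, y, s), a). (y, a)) (vout K Q)"
  have "map_pmf snd ?T' = map_pmf (\<lambda>(y, a). y @ [a]) p"
    by (simp add: p_def transcript_Suc vout_def Q_def bind_map_pmf map_bind_pmf pmf.map_comp o_def
        case_prod_unfold)
  moreover have "ent (map_pmf (\<lambda>(y, a). y @ [a]) p) = ent p"
    by (intro ent_map_inj) (auto simp: inj_on_def)
  moreover have "map_pmf fst p = map_pmf snd ?T"
    by (simp add: p_def vout_def Q_def bind_map_pmf map_bind_pmf pmf.map_comp o_def
        case_prod_unfold map_pmf_const) (simp add: map_pmf_def)
  moreover have "map_pmf snd p = map_pmf snd (vout K Q)"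
    by (simp add: p_def pmf.map_comp o_def case_prod_unfold)
  moreover have "ent p \<le> ent (map_pmf fst p) + ent (map_pmf snd p)"
    by (intro ent_subadditive) (simp add: p_def fK)
  moreover have "gp_value K state Q \<le> C"
    by (rule C[OF fQ PS])
  ultimately show ?case
    using Suc by (simp add: gp_value_def PS HK HL algebra_simps)
qed

text \<open>At time \<open>n\<close> no future states remain, so the telescoped bound reads H(Y) -
  H(W,Y) \<le> n C - log |A| for the whole output sequence Y; the state entropies have cancelled by
  independence of W and the states. Fano's inequality bounds the left side from below.\<close>

lemma gp_converse:
  fixes K :: "'s::finite \<times> 'x::finite \<Rightarrow> 'y::finite pmf"
    and e :: "nat \<Rightarrow> 'w \<times> 's list \<Rightarrow> 'y list \<Rightarrow> 's \<times> 'x"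
  assumes A: "finite A" "A \<noteq> {}"
    and M: "M = pair_pmf (pmf_of_set A) (replicate_pmf n PS)"
    and e: "\<And>k w s y. fst (e k (w, s) y) = s ! k"
    and C: "\<And>Q :: (('w \<times> 'y list \<times> 's list) \<times> 's \<times> 'x) pmf. finite (set_pmf Q) \<Longrightarrow>
      map_pmf snd (vout state Q) = PS \<Longrightarrow> gp_value K state Q \<le> C"
  shows "(1 - measure_pmf.prob (transcript K e M n) {((w, s), y). g y \<noteq> w}) * log 2 (real (card A))
    \<le> 1 + real n * C"
proof -
  let ?T = "transcript K e M n"
  define p where "p = map_pmf (\<lambda>((w, s), y). (w, y)) ?T"
  have fM: "finite (set_pmf M)"
    using A by (simp add: M finite_replicate_pmf)
  have fp: "finite (set_pmf p)"
    by (simp add: p_def finite_transcript fM)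
  have len: "w \<in> A" "length s = n" if "((w, s), y) \<in> set_pmf ?T" for w s y
  proof -
    have "fst ((w, s), y) \<in> set_pmf (map_pmf fst ?T)"
      using that by (simp only: set_map_pmf imageI)
    then show "w \<in> A" "length s = n"
      using A by (simp_all add: map_fst_transcript M set_replicate_pmf)
  qed
  have "ent (pmf_of_set A) = log 2 (real (card A))"
    using A by (simp add: ent_def log_divide card_gt_0_iff)
  moreover have "ent M = ent (pmf_of_set A) + ent (replicate_pmf n PS)"
    unfolding M using A by (intro ent_pair_pmf) (simp_all add: finite_replicate_pmf)
  ultimately have M_eq: "ent M = log 2 (real (card A)) + real n * ent PS"
    by (simp add: ent_replicate_pmf)
  have "map_pmf (\<lambda>((w, s), y). (w, y, drop n s)) ?T = map_pmf (\<lambda>(w, y). (w, y, [])) p"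
    unfolding p_def pmf.map_comp by (intro map_pmf_cong refl) (auto dest: len(2))
  also have "ent \<dots> = ent p"
    by (intro ent_map_inj) (auto simp: inj_on_def)
  finally have p_ent: "ent (map_pmf (\<lambda>((w, s), y). (w, y, drop n s)) ?T) = ent p" .
  have "ent (map_pmf snd ?T) - ent (map_pmf (\<lambda>((w, s), y). (w, y, drop n s)) ?T)
      \<le> real n * (C + ent PS) - ent M"
  proof (rule converse_telescope[OF M])
    show "finite (set_pmf (pmf_of_set A))" using A by simp
    show "gp_value K state Q \<le> C" if "finite (set_pmf Q)" "map_pmf snd (vout state Q) = PS"
      for Q :: "(('w \<times> 'y list \<times> 's list) \<times> 's \<times> 'x) pmf"
      using that by (rule C)
  qed (simp_all only: e order_refl)
  then have "ent (map_pmf snd ?T) - ent p \<le> real n * (C + ent PS) - ent M"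
    by (simp only: p_ent)
  moreover have "map_pmf snd ?T = map_pmf snd p"
    by (simp add: p_def pmf.map_comp o_def case_prod_unfold)
  moreover have "ent p \<le> ent (map_pmf snd p) + 1 +
      measure_pmf.prob p {(w, y). g y \<noteq> w} * log 2 (real (card A))"
    using A by (intro fano fp) (auto simp: p_def dest: len)
  moreover have "measure_pmf.prob p {(w, y). g y \<noteq> w} =
      measure_pmf.prob ?T {((w, s), y). g y \<noteq> w}"
    by (simp add: p_def vimage_def case_prod_unfold)
  ultimately show ?thesis
    using M_eq by (simp add: algebra_simps)
qed

section \<open>From the error probability to the sum-rate bound\<close>

text \<open>The message pair is read as one uniform message and the two encoders as one; the product
  formulas for the states and for the outputs then give the explicit sum.\<close>

lemma pe_eq_prob:
  fixes PS :: "'s::finite pmf"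
    and W :: "'x1::finite \<Rightarrow> 'x2::finite \<Rightarrow> 's \<Rightarrow> 'y::finite pmf"
  assumes A: "A = {..<M1} \<times> {..<M2}" and M12: "0 < M1" "0 < M2"
    and M: "M = pair_pmf (pmf_of_set A) (replicate_pmf n PS)"
    and e: "e = (\<lambda>k ((w1, w2), s) y. (s ! k, f1 k w1 s y, f2 k w2 s y))"
  shows "pe PS W n M1 M2 f1 f2 g =
    measure_pmf.prob (transcript (mac W) e M n) {((w, s), y). g y \<noteq> w}"
proof -
  let ?T = "transcript (mac W) e M n"
  let ?S = "{s :: 's list. length s = n}" and ?Y = "{y :: 'y list. length y = n}"
  let ?err = "{((w, s), y). g y \<noteq> w}"
  have A': "finite A" "A \<noteq> {}" "card A = M1 * M2"
    using M12 by (auto simp: A)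
  have fin: "finite ?S" "finite ?Y"
    using finite_lists_length_eq[of "UNIV :: 's set" n] finite_lists_length_eq[of "UNIV :: 'y set" n]
    by simp_all
  have fM: "finite (set_pmf M)"
    using A' by (simp add: M finite_replicate_pmf)
  have T: "pmf ?T ((w, s), y) = 1 / (real M1 * real M2) * ((\<Prod>k<n. pmf PS (s ! k)) *
      (\<Prod>k<n. pmf (W (f1 k (fst w) s (take k y)) (f2 k (snd w) s (take k y)) (s ! k)) (y ! k)))"
    if "w \<in> A" "s \<in> ?S" "y \<in> ?Y" for w s y
    using that A' by (simp add: transcript_def pmf_bind_Pair[OF fM[unfolded M]] M pmf_pair pmf_replicate_pmf
        pmf_fb_out e mac_def case_prod_unfold)
  have sub: "set_pmf ?T \<subseteq> (A \<times> ?S) \<times> ?Y"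
    using A' by (auto simp: transcript_def M set_replicate_pmf dest: length_fb_out)
  have "measure_pmf.prob ?T ?err = measure_pmf.expectation ?T (indicator ?err)"
    by simp
  also have "\<dots> = (\<Sum>x\<in>(A \<times> ?S) \<times> ?Y. pmf ?T x *\<^sub>R indicator ?err x)"
    using A' fin sub by (intro integral_measure_pmf) auto
  also have "\<dots> = (\<Sum>w\<in>A. \<Sum>s\<in>?S. \<Sum>y\<in>?Y. pmf ?T ((w, s), y) * (if g y \<noteq> w then 1 else 0))"
    by (simp add: sum.cartesian_product' indicator_def of_bool_def)
  also have "\<dots> = (\<Sum>w\<in>A. \<Sum>s\<in>?S. \<Sum>y\<in>?Y. 1 / (real M1 * real M2) * ((\<Prod>k<n. pmf PS (s ! k)) *
      (\<Prod>k<n. pmf (W (f1 k (fst w) s (take k y)) (f2 k (snd w) s (take k y)) (s ! k)) (y ! k)) *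
      (if g y \<noteq> w then 1 else 0)))"
    by (intro sum.cong refl) (simp add: T del: mem_Collect_eq)
  also have "\<dots> = pe PS W n M1 M2 f1 f2 g"
    by (simp only: pe_def A sum.cartesian_product' sum_distrib_left fst_conv snd_conv)
  finally show ?thesis ..
qed

text \<open>The converse at block length n, divided by n, loses its additive constant and its error
  term in the limit.\<close>

lemma achievable_sum_bound:
  fixes PS :: "'s::finite pmf"
    and W :: "'x1::finite \<Rightarrow> 'x2::finite \<Rightarrow> 's \<Rightarrow> 'y::finite pmf"
  assumes ach: "achievable PS W R1 R2"
    and C: "\<And>Q :: (((nat \<times> nat) \<times> 'y list \<times> 's list) \<times> 's \<times> 'x1 \<times> 'x2) pmf.
      finite (set_pmf Q) \<Longrightarrow> map_pmf snd (vout state Q) = PS \<Longrightarrow> gp_value (mac W) state Q \<le> C"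
  shows "R1 + R2 \<le> C"
proof -
  obtain f1 f2 g where R: "0 \<le> R1" "0 \<le> R2"
    and lim: "(\<lambda>n. pe PS W n (msize n R1) (msize n R2) (f1 n) (f2 n) (g n)) \<longlonglongrightarrow> 0"
    using ach unfolding achievable_def by blast
  define \<epsilon> where "\<epsilon> n = pe PS W n (msize n R1) (msize n R2) (f1 n) (f2 n) (g n)" for n
  have bound: "(1 - \<epsilon> n) * (R1 + R2) \<le> 1 / real n + C" if n: "0 < n" for n
  proof -
    \<comment> \<open>Rounding up only enlarges the message sets, so log |A| is at least n (R1 +
      R2).\<close>
    have size: "2 powr (real n * R) \<le> real (msize n R)" for R
      unfolding msize_def by linarith
    have pos: "0 < msize n R" for R
      unfolding msize_def by simp
    let ?A = "{..<msize n R1} \<times> {..<msize n R2}"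
    let ?M = "pair_pmf (pmf_of_set ?A) (replicate_pmf n PS)"
    let ?e = "\<lambda>k ((w1, w2), s) y. (s ! k, f1 n k w1 s y, f2 n k w2 s y)"
    have \<epsilon>: "\<epsilon> n = measure_pmf.prob (transcript (mac W) ?e ?M n) {((w, s), y). g n y \<noteq> w}"
      unfolding \<epsilon>_def by (rule pe_eq_prob[OF refl pos pos refl refl])
    have "(1 - \<epsilon> n) * log 2 (real (card ?A)) \<le> 1 + real n * C"
      unfolding \<epsilon> using pos[of R1] pos[of R2]
      by (intro gp_converse[OF _ _ refl _ C]) auto
    moreover have "real n * (R1 + R2) \<le> log 2 (real (card ?A))"
    proof -
      have "2 powr (real n * (R1 + R2)) = 2 powr (real n * R1) * 2 powr (real n * R2)"
        by (simp add: distrib_left powr_add)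
      also have "\<dots> \<le> real (card ?A)"
        using size[of R1] size[of R2] by (simp add: mult_mono)
      finally show ?thesis
        using pos by (subst le_log_iff) simp_all
    qed
    \<comment> \<open>Makes the factor \<open>1 - \<epsilon> n\<close> nonnegative, so the lower
      bound on log |A| may be multiplied by it.\<close>
    moreover have "\<epsilon> n \<le> 1"
      unfolding \<epsilon> by simp
    ultimately have "(1 - \<epsilon> n) * (real n * (R1 + R2)) \<le> 1 + real n * C"
      by (meson diff_ge_0_iff_ge mult_left_mono order_trans)
    then show ?thesis
      using n by (simp add: field_simps)
  qed
  have "(\<lambda>n. (1 - \<epsilon> n) * (R1 + R2)) \<longlonglongrightarrow> (1 - 0) * (R1 + R2)"
    using lim unfolding \<epsilon>_def by (intro tendsto_intros)
  moreover have "(\<lambda>n. 1 / real n + C) \<longlonglongrightarrow> 0 + C"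
    by (intro tendsto_intros lim_1_over_n)
  ultimately have "(1 - 0) * (R1 + R2) \<le> 0 + C"
    by (rule LIMSEQ_le) (use bound in \<open>auto intro!: exI[of _ 1]\<close>)
  then show ?thesis by simp
qed

theorem theorem2:
  fixes PS :: "'s::finite pmf"
    and W :: "'x1::finite \<Rightarrow> 'x2::finite \<Rightarrow> 's \<Rightarrow> 'y::finite pmf"
  shows "cap_region_fb_nc PS W \<subseteq> outer_region PS W"
proof -
  \<comment> \<open>Some admissible law must exist; constant inputs provide one.\<close>
  have "bind_pmf (map_pmf (\<lambda>s. (s, undefined :: 'x1 \<times> 'x2)) PS) state = PS"
    by (simp add: bind_map_pmf bind_return_pmf')
  from gp_value_attains_max[OF this, of "mac W"]
  obtain Q :: "(nat \<times> 's \<times> 'x1 \<times> 'x2) pmf" where Q: "finite (set_pmf Q)" "map_pmf snd (vout state Q) = PS"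
    and max: "\<And>Q' :: (((nat \<times> nat) \<times> 'y list \<times> 's list) \<times> 's \<times> 'x1 \<times> 'x2) pmf.
      finite (set_pmf Q') \<Longrightarrow> map_pmf snd (vout state Q') = PS \<Longrightarrow>
      gp_value (mac W) state Q' \<le> gp_value (mac W) state Q"
    by blast
  define C where "C = gp_value (mac W) state Q"
  let ?tri = "{x :: real \<times> real. 0 \<le> fst x \<and> 0 \<le> snd x \<and> fst x + snd x \<le> C}"
  have "{(R1, R2). achievable PS W R1 R2} \<subseteq> ?tri"
  proof clarify
    fix R1 R2 assume ach: "achievable PS W R1 R2"
    then have "R1 + R2 \<le> C"
      unfolding C_def by (rule achievable_sum_bound[OF _ max])
    with ach show "0 \<le> fst (R1, R2) \<and> 0 \<le> snd (R1, R2) \<and> fst (R1, R2) + snd (R1, R2) \<le> C"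
      by (simp add: achievable_def)
  qed
  moreover have "closed ?tri"
    by (intro closed_Collect_conj closed_Collect_le continuous_intros)
  ultimately have "cap_region_fb_nc PS W \<subseteq> ?tri"
    unfolding cap_region_fb_nc_def by (rule closure_minimal)
  moreover have "(R1, R2) \<in> outer_region PS W" if R: "0 \<le> R1" "0 \<le> R2" "R1 + R2 \<le> C" for R1 R2
  proof (rule outer_regionI[OF Q])
    have "0 \<le> C" using R by simp
    \<comment> \<open>User 1 gets the fraction R1/C of the time. If C = 0, both rates are 0 and the
      quotient is 0 by convention.\<close>
    show "0 \<le> R1 / C" "R1 / C \<le> 1"
      using R \<open>0 \<le> C\<close> by (simp_all add: divide_le_eq)
    show "R1 \<le> R1 / C * gp_value (mac W) state Q"
      using R by (cases "C = 0") (simp_all add: C_def[symmetric])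
    show "R2 \<le> (1 - R1 / C) * gp_value (mac W) state Q"
      using R by (cases "C = 0") (simp_all add: C_def[symmetric] left_diff_distrib)
  qed
  ultimately show ?thesis by auto
qed

end
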